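(* Let $(X,d)$ be a complete, proper, separable metric space which is a length space, and let $P$ be a Markov probability kernel on $X$. Suppose that for some $a>0$ and $b,\gamma,\delta\ge0$, $$a|\nabla Pf|^2+b(Pf)^2\le\gamma\,P|\nabla f|^2+\delta\,P(f^2)\quad\text{pointwise on }X,\qquad\text{for all } f\in\mathrm{Lip}_b(X).$$ Then $$W_{\gamma,\delta}(\mu_0P,\mu_1P)\le W_{a,b}(\mu_0,\mu_1)\qquad\text{for all }\mu_0,\mu_1\in\mathcal P(X).$$
   Context: For $f:X\to\mathbb R$, $|\nabla f|(x)=\lim_{r\to0}\sup_{0<d(x,y)\le r}\frac{|f(x)-f(y)|}{d(x,y)}$. $\mathrm{Lip}_b(X)$ is the Banach space of bounded Lipschitz functions on $X$ and $\mathcal P(X)$ the set of Borel probability measures on $X$. The Markov kernel $P:X\times\mathcal B_X\to[0,1]$ acts by $Pf(x)=\int_X f(y)\,P(x,dy)$ and $\mu P(A)=\int_X P(x,A)\,\mu(dx)$. For $a,b\ge0$ let $\mathcal A_{a,b}$ be the class of all $\varphi=\varphi_s(x)\in C^1([0,1],\mathrm{Lip}_b(X))$ satisfying $\partial_s\varphi_s+a|\nabla\varphi_s|^2+b\varphi_s^2\le0$. For $\mu_0,\mu_1\in\mathcal P(X)$ set $W_{a,b}(\mu_0,\mu_1)=\sup_{\varphi\in\mathcal A_{a,b}}\left[\int_X\varphi_1\,d\mu_1-\int_X\varphi_0\,d\mu_0\right]$ (possibly $+\infty$). *)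

theory Defs
  imports "HOL-Probability.Probability"
begin

text \<open>Length spaces: the distance is the infimum of the lengths of connecting continuous curves
  (\<open>\<infinity>\<close> if no rectifiable one exists).\<close>

definition curve_length :: "(real \<Rightarrow> 'a::metric_space) \<Rightarrow> ennreal" where
  "curve_length g =
     (SUP (n, t) \<in> {(n::nat, t::nat \<Rightarrow> real). t 0 = 0 \<and> t n = 1 \<and> mono_on {..n} t}.
        \<Sum>i<n. ennreal (dist (g (t i)) (g (t (Suc i)))))"

definition length_space :: "'a::metric_space itself \<Rightarrow> bool" where
  "length_space _ \<longleftrightarrow>
     (\<forall>x y :: 'a. ennreal (dist x y) =
        (INF g \<in> {g. path g \<and> pathstart g = x \<and> pathfinish g = y}. curve_length g))"

definition proper_space :: "'a::metric_space itself \<Rightarrow> bool" where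
  "proper_space _ \<longleftrightarrow> (\<forall>(x::'a) r. compact (cball x r))"


text \<open>The pointwise Lipschitz constant \<open>|\<nabla>f|(x)\<close>. It is taken in \<^typ>\<open>ennreal\<close>, so it may be infinite,
  and the empty supremum (at an isolated point) is \<open>0\<close>. The limit always exists, by
  monotonicity in \<open>r\<close> (lemma \<open>tendsto_slope\<close>).\<close>

definition slope :: "('a::metric_space \<Rightarrow> real) \<Rightarrow> 'a \<Rightarrow> ennreal" where
  "slope f x =
     Lim (at_right 0) (\<lambda>r::real. SUP y \<in> {y. 0 < dist x y \<and> dist x y \<le> r}.
       ennreal (\<bar>f x - f y\<bar> / dist x y))"

lemma tendsto_slope:
  "((\<lambda>r::real. SUP y \<in> {y. 0 < dist x y \<and> dist x y \<le> r}. ennreal (\<bar>f x - f y\<bar> / dist x y))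
      \<longlongrightarrow> slope f x) (at_right 0)"
proof -
  let ?F = "\<lambda>r::real. SUP y \<in> {y. 0 < dist x y \<and> dist x y \<le> r}.
       ennreal (\<bar>f x - f y\<bar> / dist x y)"
  have mono: "?F r \<le> ?F s" if "r \<le> s" for r s
    using that by (intro SUP_subset_mono) auto
  have "(?F \<longlongrightarrow> (INF r\<in>{0<..}. ?F r)) (at_right 0)"
  proof (rule order_tendstoI)
    fix c assume "c < (INF r\<in>{0<..}. ?F r)"
    then have "c < ?F r" if "0 < r" for r
      using that by (meson INF_lower greaterThan_iff less_le_trans)
    then show "\<forall>\<^sub>F r in at_right 0. c < ?F r"
      by (auto simp: eventually_at_right_field intro: exI[of _ 1])
  next
    fix c assume "(INF r\<in>{0<..}. ?F r) < c"
    then obtain r where r: "0 < r" "?F r < c"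
      unfolding INF_less_iff by blast
    have "?F s < c" if "s < r" for s
      using mono[of s r] r(2) that by (meson le_less_trans less_imp_le)
    with r(1) show "\<forall>\<^sub>F r in at_right 0. ?F r < c"
      unfolding eventually_at_right_field by blast
  qed
  then show ?thesis
    unfolding slope_def by (subst tendsto_Lim) auto
qed

lemma slope_le_lipschitz:
  assumes "L-lipschitz_on UNIV f"
  shows "slope f x \<le> ennreal L"
proof (rule tendsto_upperbound[OF tendsto_slope])
  show "\<forall>\<^sub>F r in at_right 0. (SUP y \<in> {y. 0 < dist x y \<and> dist x y \<le> r}.
       ennreal (\<bar>f x - f y\<bar> / dist x y)) \<le> ennreal L"
  proof (intro always_eventually allI SUP_least ennreal_leI)
    fix r :: real and y assume "y \<in> {y. 0 < dist x y \<and> dist x y \<le> r}"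
    then show "\<bar>f x - f y\<bar> / dist x y \<le> L"
      using lipschitz_onD[OF assms, of x y] by (simp add: dist_real_def field_simps)
  qed
qed simp


text \<open>\<open>Lip\<^sub>b(X)\<close> with the norm \<open>sup |f| + Lip(f)\<close>.\<close>

typedef (overloaded) 'a lipb =
  "{f :: 'a::metric_space \<Rightarrow> real. bounded (range f) \<and> (\<exists>L. L-lipschitz_on UNIV f)}"
  morphisms apply_lipb Lipb
  by (rule exI[of _ "\<lambda>_. 0"]) (auto simp: lipschitz_on_def)

setup_lifting type_definition_lipb

lemma lipb_eqI: "(\<And>x. apply_lipb f x = apply_lipb g x) \<Longrightarrow> f = g"
  by (metis apply_lipb_inject ext)

instantiation lipb :: (metric_space) real_vector
begin

lift_definition zero_lipb :: "'a lipb" is "\<lambda>_. 0"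
  by (auto simp: lipschitz_on_def)

lift_definition plus_lipb :: "'a lipb \<Rightarrow> 'a lipb \<Rightarrow> 'a lipb" is "\<lambda>f g x. f x + g x"
  by (auto intro!: bounded_plus_comp lipschitz_on_add)

lift_definition uminus_lipb :: "'a lipb \<Rightarrow> 'a lipb" is "\<lambda>f x. - f x"
  by auto

lift_definition minus_lipb :: "'a lipb \<Rightarrow> 'a lipb \<Rightarrow> 'a lipb" is "\<lambda>f g x. f x - g x"
  by (auto intro!: bounded_minus_comp lipschitz_on_diff)

lift_definition scaleR_lipb :: "real \<Rightarrow> 'a lipb \<Rightarrow> 'a lipb" is "\<lambda>c f x. c * f x"
proof safe
  fix c L :: real and f :: "'a \<Rightarrow> real"
  assume "bounded (range f)" then show "bounded (range (\<lambda>x. c * f x))"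
    using bounded_scaleR_comp[of f UNIV c] by simp
next
  fix c L :: real and f :: "'a \<Rightarrow> real"
  assume "L-lipschitz_on UNIV f" then show "\<exists>L. L-lipschitz_on UNIV (\<lambda>x. c * f x)"
    using lipschitz_on_cmult_real by blast
qed

lemmas lipb_apply_simps [simp] =
  zero_lipb.rep_eq plus_lipb.rep_eq uminus_lipb.rep_eq minus_lipb.rep_eq scaleR_lipb.rep_eq

instance
  by standard (auto intro!: lipb_eqI simp: algebra_simps)

end

definition sup_norm :: "('a \<Rightarrow> real) \<Rightarrow> real" where
  "sup_norm f = (SUP x. \<bar>f x\<bar>)"

text \<open>Pairs with \<open>x = y\<close> contribute \<open>0 / 0 = 0\<close>, which does not change the supremum.\<close>

definition Lip_const :: "('a::metric_space \<Rightarrow> real) \<Rightarrow> real" where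
  "Lip_const f = (SUP (x, y). \<bar>f x - f y\<bar> / dist x y)"

lemma lipb_bounded: "bounded (range (apply_lipb f))"
  and lipb_lipschitz: "\<exists>L. L-lipschitz_on UNIV (apply_lipb f)"
  using apply_lipb[of f] by auto

lemma abs_le_sup_norm: "\<bar>apply_lipb f x\<bar> \<le> sup_norm (apply_lipb f)"
proof -
  obtain B where "\<And>x. \<bar>apply_lipb f x\<bar> \<le> B"
    using lipb_bounded[of f] by (auto simp: bounded_iff)
  then show ?thesis
    unfolding sup_norm_def by (intro cSUP_upper bdd_aboveI2) auto
qed

lemma sup_norm_le: "(\<And>x. \<bar>f x\<bar> \<le> B) \<Longrightarrow> sup_norm f \<le> B"
  unfolding sup_norm_def by (rule cSUP_least) auto

lemma Lip_const_quot_le: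
  "\<bar>apply_lipb f x - apply_lipb f y\<bar> / dist x y \<le> Lip_const (apply_lipb f)"
proof -
  obtain L where L: "L-lipschitz_on UNIV (apply_lipb f)"
    using lipb_lipschitz by blast
  have "\<bar>apply_lipb f x - apply_lipb f y\<bar> / dist x y \<le> L" for x y
    using lipschitz_onD[OF L, of x y] lipschitz_on_nonneg[OF L]
    by (cases "x = y") (auto simp: dist_real_def field_simps)
  then have "bdd_above (range (\<lambda>(x, y). \<bar>apply_lipb f x - apply_lipb f y\<bar> / dist x y))"
    by (intro bdd_aboveI2[where M = L]) auto
  from cSUP_upper[OF UNIV_I[of "(x, y)"] this] show ?thesis
    by (simp add: Lip_const_def)
qed

lemma Lip_const_nonneg: "0 \<le> Lip_const (apply_lipb f)"
  using Lip_const_quot_le[of f undefined undefined] by simp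

lemma lipschitz_Lip_const: "(Lip_const (apply_lipb f))-lipschitz_on UNIV (apply_lipb f)"
proof (rule lipschitz_onI)
  show "dist (apply_lipb f x) (apply_lipb f y) \<le> Lip_const (apply_lipb f) * dist x y" for x y
    using Lip_const_quot_le[of f x y]
    by (cases "x = y") (auto simp: dist_real_def field_simps)
qed (rule Lip_const_nonneg)

lemma Lip_const_le:
  assumes "L-lipschitz_on UNIV f"
  shows "Lip_const f \<le> L"
  unfolding Lip_const_def
proof (rule cSUP_least)
  fix p :: "'a \<times> 'a"
  show "(case p of (x, y) \<Rightarrow> \<bar>f x - f y\<bar> / dist x y) \<le> L"
    using lipschitz_onD[OF assms, of "fst p" "snd p"] lipschitz_on_nonneg[OF assms]
    by (cases "fst p = snd p") (auto simp: dist_real_def field_simps split: prod.split)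
qed simp

instantiation lipb :: (metric_space) real_normed_vector
begin

definition norm_lipb :: "'a lipb \<Rightarrow> real" where
  "norm_lipb f = sup_norm (apply_lipb f) + Lip_const (apply_lipb f)"

definition dist_lipb :: "'a lipb \<Rightarrow> 'a lipb \<Rightarrow> real" where
  "dist_lipb f g = norm (f - g)"

definition sgn_lipb :: "'a lipb \<Rightarrow> 'a lipb" where
  "sgn_lipb f = f /\<^sub>R norm f"

definition uniformity_lipb :: "('a lipb \<times> 'a lipb) filter" where
  "uniformity_lipb = (INF e\<in>{0 <..}. principal {(x, y). dist x y < e})"

definition open_lipb :: "'a lipb set \<Rightarrow> bool" where
  "open_lipb S = (\<forall>x\<in>S. \<forall>\<^sub>F (x', y) in uniformity. x' = x \<longrightarrow> y \<in> S)"

instance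
proof
  fix c :: real and f g :: "'a lipb"
  have nonneg: "0 \<le> sup_norm (apply_lipb h)" for h :: "'a lipb"
    using abs_le_sup_norm[of h undefined] by linarith
  show "norm f = 0 \<longleftrightarrow> f = 0"
  proof
    assume "norm f = 0"
    then have "sup_norm (apply_lipb f) = 0"
      using nonneg[of f] Lip_const_nonneg[of f] by (simp add: norm_lipb_def)
    then have "apply_lipb f x = 0" for x
      using abs_le_sup_norm[of f x] by simp
    then show "f = 0"
      by (intro lipb_eqI) simp
  qed (simp add: norm_lipb_def sup_norm_def Lip_const_def case_prod_unfold)
  have "sup_norm (apply_lipb (f + g)) \<le> sup_norm (apply_lipb f) + sup_norm (apply_lipb g)"
  proof (rule sup_norm_le)
    show "\<bar>apply_lipb (f + g) x\<bar> \<le> sup_norm (apply_lipb f) + sup_norm (apply_lipb g)" for x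
      using abs_le_sup_norm[of f x] abs_le_sup_norm[of g x] by simp
  qed
  moreover have "Lip_const (apply_lipb (f + g)) \<le> Lip_const (apply_lipb f) + Lip_const (apply_lipb g)"
    unfolding plus_lipb.rep_eq
    by (intro Lip_const_le lipschitz_on_add lipschitz_Lip_const)
  ultimately show "norm (f + g) \<le> norm f + norm g"
    by (simp add: norm_lipb_def)
  have le: "norm (k *\<^sub>R h) \<le> \<bar>k\<bar> * norm h" for k and h :: "'a lipb"
  proof -
    have "sup_norm (apply_lipb (k *\<^sub>R h)) \<le> \<bar>k\<bar> * sup_norm (apply_lipb h)"
      by (rule sup_norm_le) (simp add: abs_mult mult_left_mono abs_le_sup_norm)
    moreover have "Lip_const (apply_lipb (k *\<^sub>R h)) \<le> \<bar>k\<bar> * Lip_const (apply_lipb h)"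
      unfolding scaleR_lipb.rep_eq
      by (intro Lip_const_le lipschitz_on_cmult_real lipschitz_Lip_const)
    ultimately show ?thesis
      by (simp add: norm_lipb_def algebra_simps)
  qed
  show "norm (c *\<^sub>R f) = \<bar>c\<bar> * norm f"
  proof (cases "c = 0")
    case True
    then show ?thesis
      by (simp add: norm_lipb_def sup_norm_def Lip_const_def case_prod_unfold)
  next
    case False
    then have "norm f \<le> \<bar>inverse c\<bar> * norm (c *\<^sub>R f)"
      using le[of "inverse c" "c *\<^sub>R f"] by simp
    with False have "\<bar>c\<bar> * norm f \<le> norm (c *\<^sub>R f)"
      by (simp add: field_simps)
    with le[of c f] show ?thesis by simp
  qed
qed (simp_all add: dist_lipb_def sgn_lipb_def uniformity_lipb_def open_lipb_def)

end

lemma norm_lipb_leI: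
  "(\<And>x. \<bar>apply_lipb f x\<bar> \<le> B) \<Longrightarrow> L-lipschitz_on UNIV (apply_lipb f) \<Longrightarrow> norm f \<le> B + L"
  unfolding norm_lipb_def by (intro add_mono sup_norm_le Lip_const_le)

lemma abs_le_norm_lipb: "\<bar>apply_lipb f x\<bar> \<le> norm f"
  using abs_le_sup_norm[of f x] Lip_const_nonneg[of f] by (simp add: norm_lipb_def)

lemma lipschitz_norm_lipb: "(norm f)-lipschitz_on UNIV (apply_lipb f)"
  using abs_le_sup_norm[of f undefined]
  by (intro lipschitz_on_le[OF lipschitz_Lip_const]) (simp add: norm_lipb_def)

instance lipb :: (metric_space) banach
proof
  fix F :: "nat \<Rightarrow> 'a lipb"
  assume F: "Cauchy F"
  have pw: "Cauchy (\<lambda>n. apply_lipb (F n) x)" for x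
    unfolding Cauchy_def
  proof safe
    fix e :: real assume "0 < e"
    then obtain M where M: "\<And>m n. m \<ge> M \<Longrightarrow> n \<ge> M \<Longrightarrow> norm (F m - F n) < e"
      using F unfolding Cauchy_def dist_norm by metis
    have "dist (apply_lipb (F m) x) (apply_lipb (F n) x) < e" if "m \<ge> M" "n \<ge> M" for m n
      using M[OF that] abs_le_norm_lipb[of "F m - F n" x] by (simp add: dist_real_def)
    then show "\<exists>M. \<forall>m\<ge>M. \<forall>n\<ge>M. dist (apply_lipb (F m) x) (apply_lipb (F n) x) < e"
      by blast
  qed
  define f where "f x = lim (\<lambda>n. apply_lipb (F n) x)" for x
  have lim: "(\<lambda>n. apply_lipb (F n) x) \<longlonglongrightarrow> f x" for x
    unfolding f_def using pw Cauchy_convergent_iff convergent_LIMSEQ_iff by blast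
  have close: "\<exists>N. \<forall>n\<ge>N. (\<forall>x. \<bar>apply_lipb (F n) x - f x\<bar> \<le> e) \<and>
      e-lipschitz_on UNIV (\<lambda>x. apply_lipb (F n) x - f x)" if "0 < e" for e :: real
  proof -
    obtain M where M: "\<And>m n. m \<ge> M \<Longrightarrow> n \<ge> M \<Longrightarrow> norm (F m - F n) < e"
      using F \<open>0 < e\<close> unfolding Cauchy_def dist_norm by metis
    have "(\<forall>x. \<bar>apply_lipb (F n) x - f x\<bar> \<le> e) \<and>
        e-lipschitz_on UNIV (\<lambda>x. apply_lipb (F n) x - f x)" if n: "n \<ge> M" for n
    proof (intro conjI allI lipschitz_onI)
      fix x
      have "(\<lambda>m. \<bar>apply_lipb (F n) x - apply_lipb (F m) x\<bar>) \<longlonglongrightarrow> \<bar>apply_lipb (F n) x - f x\<bar>"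
        by (intro tendsto_intros lim)
      then show "\<bar>apply_lipb (F n) x - f x\<bar> \<le> e"
      proof (rule LIMSEQ_le_const2, intro exI[of _ M] allI impI)
        show "\<bar>apply_lipb (F n) x - apply_lipb (F m) x\<bar> \<le> e" if "m \<ge> M" for m
          using M[OF n that] abs_le_norm_lipb[of "F n - F m" x] by simp
      qed
    next
      fix x y
      have "(\<lambda>m. dist (apply_lipb (F n) x - apply_lipb (F m) x) (apply_lipb (F n) y - apply_lipb (F m) y))
          \<longlonglongrightarrow> dist (apply_lipb (F n) x - f x) (apply_lipb (F n) y - f y)"
        by (intro tendsto_intros lim)
      then show "dist (apply_lipb (F n) x - f x) (apply_lipb (F n) y - f y) \<le> e * dist x y"
      proof (rule LIMSEQ_le_const2, intro exI[of _ M] allI impI)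
        fix m assume "m \<ge> M"
        have "dist (apply_lipb (F n - F m) x) (apply_lipb (F n - F m) y) \<le> norm (F n - F m) * dist x y"
          by (rule lipschitz_onD[OF lipschitz_norm_lipb]) auto
        also have "\<dots> \<le> e * dist x y"
          using M[OF n \<open>m \<ge> M\<close>] by (intro mult_right_mono) auto
        finally show "dist (apply_lipb (F n) x - apply_lipb (F m) x)
            (apply_lipb (F n) y - apply_lipb (F m) y) \<le> e * dist x y"
          by simp
      qed
    qed (use \<open>0 < e\<close> in simp)
    then show ?thesis by blast
  qed
  obtain N where N: "\<forall>x. \<bar>apply_lipb (F N) x - f x\<bar> \<le> 1"
      "1-lipschitz_on UNIV (\<lambda>x. apply_lipb (F N) x - f x)"
    using close[of 1] by auto
  have "bounded (range (\<lambda>x. apply_lipb (F N) x - f x))"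
    using N(1) by (auto simp: bounded_iff)
  from bounded_minus_comp[OF lipb_bounded this]
  have "bounded (range (\<lambda>x. apply_lipb (F N) x - (apply_lipb (F N) x - f x)))" .
  moreover have "\<exists>L. L-lipschitz_on UNIV (\<lambda>x. apply_lipb (F N) x - (apply_lipb (F N) x - f x))"
    using lipschitz_on_diff[OF lipschitz_Lip_const N(2)] by blast
  ultimately have f: "apply_lipb (Lipb f) = f"
    by (intro Lipb_inverse) auto
  have "F \<longlonglongrightarrow> Lipb f"
  proof (rule LIMSEQ_I)
    fix e :: real assume "0 < e"
    then obtain M where M: "\<And>n. n \<ge> M \<Longrightarrow> (\<forall>x. \<bar>apply_lipb (F n) x - f x\<bar> \<le> e / 3) \<and>
        (e / 3)-lipschitz_on UNIV (\<lambda>x. apply_lipb (F n) x - f x)"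
      using close[of "e / 3"] by auto
    have "norm (F n - Lipb f) < e" if "n \<ge> M" for n
    proof -
      have "norm (F n - Lipb f) \<le> e / 3 + e / 3"
        using M[OF that] by (intro norm_lipb_leI) (auto simp: f)
      with \<open>0 < e\<close> show ?thesis by simp
    qed
    then show "\<exists>M. \<forall>n\<ge>M. norm (F n - Lipb f) < e" by blast
  qed
  then show "convergent F"
    by (rule convergentI)
qed


text \<open>The class \<open>A\<^sub>a\<^sub>,\<^sub>b\<close>: the derivative in \<open>s\<close> is a Banach space derivative in \<open>Lip\<^sub>b(X)\<close>, one-sided at
  the endpoints of \<open>[0,1]\<close>. The conversion \<^const>\<open>enn2real\<close> is harmless here, since the slope of a
  Lipschitz function is finite (lemma \<open>slope_le_lipschitz\<close>). Values of \<open>\<phi>\<close> outside \<open>[0,1]\<close> are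
  irrelevant.\<close>

definition HJ_class :: "real \<Rightarrow> real \<Rightarrow> (real \<Rightarrow> 'a::metric_space lipb) set" where
  "HJ_class a b = {\<phi>. \<exists>\<phi>'. continuous_on {0..1} \<phi>' \<and>
     (\<forall>s\<in>{0..1}. (\<phi> has_vector_derivative \<phi>' s) (at s within {0..1}) \<and>
        (\<forall>x. apply_lipb (\<phi>' s) x + a * (enn2real (slope (apply_lipb (\<phi> s)) x))\<^sup>2 + b * (apply_lipb (\<phi> s) x)\<^sup>2 \<le> 0))}"

definition W_dist :: "real \<Rightarrow> real \<Rightarrow> 'a::metric_space measure \<Rightarrow> 'a measure \<Rightarrow> ereal" where
  "W_dist a b \<mu>0 \<mu>1 =
     (SUP \<phi> \<in> HJ_class a b. ereal ((\<integral>x. apply_lipb (\<phi> 1) x \<partial>\<mu>1) - (\<integral>x. apply_lipb (\<phi> 0) x \<partial>\<mu>0)))"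

text \<open>A Markov kernel is a measurable map into the probability measures on the Borel sets; the
  action \<open>\<mu>P\<close> on measures is then the Giry bind \<open>\<mu> \<bind> P\<close>.\<close>

definition markov_kernel :: "('a::topological_space \<Rightarrow> 'a measure) \<Rightarrow> bool" where
  "markov_kernel P \<longleftrightarrow> P \<in> borel \<rightarrow>\<^sub>M prob_algebra borel"

definition kernel_op :: "('a \<Rightarrow> 'a measure) \<Rightarrow> ('a \<Rightarrow> real) \<Rightarrow> 'a \<Rightarrow> real" where
  "kernel_op P f x = (\<integral>y. f y \<partial>P x)"

lemma emeasure_bind_markov_kernel:
  assumes "markov_kernel P" "\<mu> \<in> space (prob_algebra borel)" "A \<in> sets borel"
  shows "emeasure (\<mu> \<bind> P) A = (\<integral>\<^sup>+ x. emeasure (P x) A \<partial>\<mu>)"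
  using assms
  by (intro emeasure_bind_prob_algebra[where N = borel])
    (auto simp: markov_kernel_def cong: measurable_cong_sets)

end

theory Submission
  imports Defs
begin

text \<open>
  The kernel turns subsolutions into subsolutions: if \<open>\<phi>\<close> lies in \<^term>\<open>HJ_class \<gamma> \<delta>\<close>, then \<open>P\<phi>\<close>
  lies in \<^term>\<open>HJ_class a b\<close>. Indeed, the gradient estimate for \<open>f = \<phi>\<^sub>s\<close>, followed by the integral
  of the inequality for \<open>\<phi>\<close> against \<open>P(x, dy)\<close>, gives
  \<open>a |\<nabla>P\<phi>\<^sub>s|\<^sup>2 + b (P\<phi>\<^sub>s)\<^sup>2 \<le> P(\<gamma> |\<nabla>\<phi>\<^sub>s|\<^sup>2 + \<delta> \<phi>\<^sub>s\<^sup>2) \<le> - P(\<partial>\<^sub>s\<phi>\<^sub>s) = - \<partial>\<^sub>s(P\<phi>\<^sub>s)\<close>.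
  Because \<open>\<integral> f d(\<mu>P) = \<integral> Pf d\<mu>\<close>, every value in the supremum defining \<open>W\<^sub>\<gamma>\<^sub>,\<^sub>\<delta>(\<mu>\<^sub>0P, \<mu>\<^sub>1P)\<close> is then
  one of the values in the supremum defining \<open>W\<^sub>a\<^sub>,\<^sub>b(\<mu>\<^sub>0, \<mu>\<^sub>1)\<close>.

  The substance lies in the last equality, \<open>P\<partial>\<^sub>s\<phi> = \<partial>\<^sub>sP\<phi>\<close>, where the derivative is taken in
  \<open>Lip\<^sub>b(X)\<close>: it holds once \<open>P\<close> is a bounded linear operator on \<open>Lip\<^sub>b(X)\<close>. A Markov kernel need not
  preserve Lipschitz functions, but the gradient estimate with \<open>a > 0\<close> bounds \<open>|\<nabla>Pf|\<close> everywhere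
  by a multiple of the norm of \<open>f\<close> (\<open>slope_kernel_op_le\<close>). On a length space a pointwise bound on the
  slope is a global Lipschitz bound (\<open>slope_le_imp_lipschitz\<close>), because the local bounds can be
  added up along nearly shortest curves; \<open>bounded_linear_lipb_kernel\<close> follows.

  A second point is that splitting the integral of the inequality for \<open>\<phi>\<close> into its terms would call
  for the slope to be measurable; \<open>kernel_integral_HJ_le\<close> rearranges the inequality so that the slope
  is only integrated monotonically.
\<close>

section \<open>Bounded slope on a length space\<close>

lemma slope_less_imp_local_bound:
  fixes F :: "'a::metric_space \<Rightarrow> real"
  assumes "slope F x < ennreal K"
  obtains r where "r > 0" "\<And>y. dist x y \<le> r \<Longrightarrow> \<bar>F x - F y\<bar> \<le> K * dist x y"
proof -
  have "\<forall>\<^sub>F r in at_right (0::real).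
      (SUP y \<in> {y. 0 < dist x y \<and> dist x y \<le> r}. ennreal (\<bar>F x - F y\<bar> / dist x y)) < ennreal K"
    using order_tendstoD(2)[OF tendsto_slope assms] .
  then obtain R where R: "R > 0" "\<And>r. 0 < r \<Longrightarrow> r < R \<Longrightarrow>
      (SUP y \<in> {y. 0 < dist x y \<and> dist x y \<le> r}. ennreal (\<bar>F x - F y\<bar> / dist x y)) < ennreal K"
    unfolding eventually_at_right_field by auto
  show thesis
  proof (rule that[of "R / 2"])
    show "R / 2 > 0" using \<open>R > 0\<close> by simp
    fix y assume y: "dist x y \<le> R / 2"
    show "\<bar>F x - F y\<bar> \<le> K * dist x y"
    proof (cases "x = y")
      case False
      then have "ennreal (\<bar>F x - F y\<bar> / dist x y)
          \<le> (SUP y \<in> {y. 0 < dist x y \<and> dist x y \<le> R / 2}. ennreal (\<bar>F x - F y\<bar> / dist x y))"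
        using y by (intro SUP_upper) auto
      also have "\<dots> < ennreal K"
        using R(1) by (intro R(2)) auto
      finally have "\<bar>F x - F y\<bar> / dist x y < K"
        by (simp add: ennreal_less_iff)
      with False show ?thesis by (simp add: field_simps)
    qed simp
  qed
qed

lemma ennreal_chain_sum_le_curve_length:
  assumes "\<tau> 0 = 0" "\<tau> n = 1" "mono_on {..n} \<tau>"
  shows "ennreal (\<Sum>i<n. dist (g (\<tau> i)) (g (\<tau> (Suc i)))) \<le> curve_length g"
proof -
  have "(\<Sum>i<n. ennreal (dist (g (\<tau> i)) (g (\<tau> (Suc i))))) \<le> curve_length g"
    unfolding curve_length_def using assms by (intro SUP_upper2[of "(n, \<tau>)"]) auto
  then show ?thesis by (simp add: sum_ennreal)
qed

text \<open>
  The slope bound at each point \<open>g x\<close> of the curve controls only the increments of \<open>F\<close> between \<open>g x\<close>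
  and nearby points, with a radius that depends on \<open>x\<close> and need not be bounded below. A partition of
  \<open>[0,1]\<close> subordinate to these radii is what Cousin's lemma provides, in the form of the induction
  principle \<open>Bolzano\<close> for intervals: the existence of a partition over which \<open>F\<close> varies by at most
  \<open>K\<close> times the length of the inscribed polygon is local, and is inherited by concatenation.
\<close>

lemma variation_le_curve_length:
  fixes F :: "'a::metric_space \<Rightarrow> real"
  assumes slope: "\<And>x. slope F x < ennreal K" and g: "path g"
  shows "ennreal \<bar>F (pathfinish g) - F (pathstart g)\<bar> \<le> ennreal K * curve_length g"
proof -
  define V where "V n \<tau> = (\<Sum>i<n. dist (g (\<tau> i)) (g (\<tau> (Suc i))))" for n and \<tau> :: "nat \<Rightarrow> real"
  define Q where "Q s t \<longleftrightarrow> (\<exists>n \<tau>. \<tau> 0 = s \<and> \<tau> n = t \<and> mono_on {..n} \<tau> \<and>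
      \<bar>F (g t) - F (g s)\<bar> \<le> K * V n \<tau>)" for s t
  have K: "K > 0"
    using le_less_trans[OF zero_le slope[of undefined]] by simp
  have "0 \<le> (0::real) \<longrightarrow> (1::real) \<le> 1 \<longrightarrow> Q 0 1"
  proof (rule Bolzano[where P = "\<lambda>s t. 0 \<le> s \<longrightarrow> t \<le> 1 \<longrightarrow> Q s t"])
    fix s t u :: real
    assume st: "0 \<le> s \<longrightarrow> t \<le> 1 \<longrightarrow> Q s t" and tu: "0 \<le> t \<longrightarrow> u \<le> 1 \<longrightarrow> Q t u"
      and le: "s \<le> t" "t \<le> u"
    show "0 \<le> s \<longrightarrow> u \<le> 1 \<longrightarrow> Q s u"
    proof (intro impI)
      assume "0 \<le> s" "u \<le> 1"
      with st le obtain n \<sigma> where \<sigma>: "\<sigma> 0 = s" "\<sigma> n = t" "mono_on {..n} \<sigma>"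
          "\<bar>F (g t) - F (g s)\<bar> \<le> K * V n \<sigma>"
        by (auto simp: Q_def)
      from \<open>0 \<le> s\<close> \<open>u \<le> 1\<close> tu le obtain m \<tau> where \<tau>: "\<tau> 0 = t" "\<tau> m = u" "mono_on {..m} \<tau>"
          "\<bar>F (g u) - F (g t)\<bar> \<le> K * V m \<tau>"
        by (auto simp: Q_def)
      define \<rho> where "\<rho> i = (if i \<le> n then \<sigma> i else \<tau> (i - n))" for i
      have \<rho>_shift: "\<rho> (n + i) = \<tau> i" for i
        using \<sigma>(2) \<tau>(1) by (cases i) (auto simp: \<rho>_def)
      have \<rho>_low: "\<rho> i = \<sigma> i" if "i \<le> n" for i
        using that by (simp add: \<rho>_def)
      have "mono_on {..n + m} \<rho>"
      proof (rule mono_onI)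
        fix i j assume ij: "i \<in> {..n + m}" "j \<in> {..n + m}" "i \<le> j"
        have low: "\<sigma> i \<le> t" if "i \<le> n"
          using mono_onD[OF \<sigma>(3), of i n] that \<sigma>(2) by simp
        have high: "t \<le> \<tau> (j - n)"
          using mono_onD[OF \<tau>(3), of 0 "j - n"] ij \<tau>(1) by simp
        consider "j \<le> n" | "i \<le> n" "n < j" | "n < i" by linarith
        then show "\<rho> i \<le> \<rho> j"
        proof cases
          case 1
          then show ?thesis using mono_onD[OF \<sigma>(3), of i j] ij by (simp add: \<rho>_def)
        next
          case 2
          then show ?thesis using low high by (simp add: \<rho>_def)
        next
          case 3
          then show ?thesis using mono_onD[OF \<tau>(3), of "i - n" "j - n"] ij by (simp add: \<rho>_def)
        qed
      qed
      moreover have "V (n + m) \<rho> = V n \<sigma> + V m \<tau>"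
      proof -
        have "V (n + m) \<rho> = (\<Sum>i<n. dist (g (\<rho> i)) (g (\<rho> (Suc i))))
            + (\<Sum>i<m. dist (g (\<rho> (n + i))) (g (\<rho> (Suc (n + i)))))"
          unfolding V_def by (induction m) (simp_all)
        also have "\<dots> = V n \<sigma> + V m \<tau>"
          unfolding V_def using \<rho>_shift \<rho>_shift[of "Suc _"]
          by (intro arg_cong2[where f = "(+)"] sum.cong) (auto simp: \<rho>_low)
        finally show ?thesis .
      qed
      moreover have "\<rho> 0 = s" "\<rho> (n + m) = u"
        using \<sigma>(1) \<tau>(2) by (simp_all add: \<rho>_low \<rho>_shift)
      moreover have "\<bar>F (g u) - F (g s)\<bar> \<le> K * (V n \<sigma> + V m \<tau>)"
        using \<sigma>(4) \<tau>(4) by (simp add: distrib_left)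
      ultimately show "Q s u"
        unfolding Q_def by metis
    qed
  next
    fix x :: real assume x: "0 \<le> x" "x \<le> 1"
    obtain r where r: "r > 0" "\<And>y. dist (g x) y \<le> r \<Longrightarrow> \<bar>F (g x) - F y\<bar> \<le> K * dist (g x) y"
      using slope_less_imp_local_bound[OF slope] by blast
    from g x \<open>r > 0\<close> have "\<exists>d>0. \<forall>t\<in>{0..1}. dist t x < d \<longrightarrow> dist (g t) (g x) < r"
      unfolding path_def continuous_on_iff by auto
    then obtain d where d: "d > 0"
        "\<And>t. 0 \<le> t \<Longrightarrow> t \<le> 1 \<Longrightarrow> \<bar>t - x\<bar> < d \<Longrightarrow> dist (g t) (g x) < r"
      by (auto simp: dist_real_def)
    show "\<exists>d>0. \<forall>s t. s \<le> x \<and> x \<le> t \<and> t - s < d \<longrightarrow> 0 \<le> s \<longrightarrow> t \<le> 1 \<longrightarrow> Q s t"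
    proof (intro exI[of _ d] conjI allI impI, fact)
      fix s t assume st: "s \<le> x \<and> x \<le> t \<and> t - s < d" "0 \<le> s" "t \<le> 1"
      \<comment> \<open>The slope is centred at \<open>g x\<close>, so \<open>x\<close> itself has to be a partition point.\<close>
      define \<tau> where "\<tau> i = (if i = 0 then s else if i = 1 then x else t)" for i :: nat
      have "\<bar>F (g x) - F (g s)\<bar> \<le> K * dist (g s) (g x)" "\<bar>F (g x) - F (g t)\<bar> \<le> K * dist (g x) (g t)"
        using r(2)[of "g s"] r(2)[of "g t"] d(2)[of s] d(2)[of t] st x
        by (auto simp: dist_commute)
      then have "\<bar>F (g t) - F (g s)\<bar> \<le> K * (dist (g s) (g x) + dist (g x) (g t))"
        by (simp add: distrib_left)
      also have "dist (g s) (g x) + dist (g x) (g t) = V 2 \<tau>"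
        by (simp add: V_def \<tau>_def numeral_2_eq_2)
      finally have "\<bar>F (g t) - F (g s)\<bar> \<le> K * V 2 \<tau>" .
      moreover have "mono_on {..2} \<tau>"
        using st by (auto simp: mono_on_def \<tau>_def)
      moreover have "\<tau> 0 = s" "\<tau> 2 = t" by (simp_all add: \<tau>_def)
      ultimately show "Q s t"
        unfolding Q_def by blast
    qed
  qed simp
  then obtain n \<tau> where \<tau>: "\<tau> 0 = 0" "\<tau> n = 1" "mono_on {..n} \<tau>"
      "\<bar>F (g 1) - F (g 0)\<bar> \<le> K * V n \<tau>"
    by (auto simp: Q_def)
  have "ennreal \<bar>F (g 1) - F (g 0)\<bar> \<le> ennreal (K * V n \<tau>)"
    using \<tau>(4) by (rule ennreal_leI)
  also have "\<dots> = ennreal K * ennreal (V n \<tau>)"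
    using K by (simp add: ennreal_mult' )
  also have "\<dots> \<le> ennreal K * curve_length g"
    unfolding V_def using ennreal_chain_sum_le_curve_length[OF \<tau>(1-3)]
    by (intro mult_left_mono) auto
  finally show ?thesis
    by (simp add: pathfinish_def pathstart_def)
qed

text \<open>
  Two approximations cost an \<open>e\<close> each: the slope has to be strictly below the constant to give a local
  Lipschitz bound, and the distance is only an infimum of lengths.
\<close>

lemma slope_le_imp_lipschitz:
  fixes F :: "'a::metric_space \<Rightarrow> real"
  assumes len: "length_space TYPE('a)" and C: "C \<ge> 0" and slope: "\<And>x. slope F x \<le> ennreal C"
  shows "C-lipschitz_on UNIV F"
proof (rule lipschitz_onI)
  fix x y :: 'a
  have "\<bar>F y - F x\<bar> \<le> C * dist x y + e * (C + dist x y + e)" if e: "e > 0" for e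
  proof -
    have K: "slope F z < ennreal (C + e)" for z
      using slope[of z] C e by (auto intro!: le_less_trans[OF slope] simp: ennreal_less_iff)
    have "(INF g \<in> {g. path g \<and> pathstart g = x \<and> pathfinish g = y}. curve_length g)
        < ennreal (dist x y + e)"
      using len e unfolding length_space_def by (metis add_less_same_cancel1 ennreal_lessI
        add.commute less_add_same_cancel1 zero_le_dist add_nonneg_pos)
    then obtain g where g: "path g" "pathstart g = x" "pathfinish g = y"
        "curve_length g < ennreal (dist x y + e)"
      unfolding INF_less_iff by blast
    have "ennreal \<bar>F y - F x\<bar> \<le> ennreal (C + e) * curve_length g"
      using variation_le_curve_length[OF K g(1)] g(2,3) by simp
    also have "\<dots> \<le> ennreal (C + e) * ennreal (dist x y + e)"
      using g(4) by (intro mult_left_mono) auto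
    also have "\<dots> = ennreal ((C + e) * (dist x y + e))"
      using C e by (simp add: ennreal_mult)
    finally have "\<bar>F y - F x\<bar> \<le> (C + e) * (dist x y + e)"
      using C e by (subst (asm) ennreal_le_iff) auto
    then show ?thesis by (simp add: algebra_simps)
  qed
  moreover have "((\<lambda>e. C * dist x y + e * (C + dist x y + e)) \<longlongrightarrow> C * dist x y + 0 * (C + dist x y + 0))
      (at_right 0)"
    by (intro tendsto_intros)
  ultimately have "\<bar>F y - F x\<bar> \<le> C * dist x y + 0 * (C + dist x y + 0)"
    by (intro tendsto_lowerbound[where F = "at_right (0::real)"])
      (auto simp: eventually_at_right_field intro!: exI[of _ 1])
  then show "dist (F x) (F y) \<le> C * dist x y"
    by (simp add: dist_real_def abs_minus_commute)
qed (fact C)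

section \<open>The kernel as an operator\<close>

lemma apply_lipb_measurable [measurable]:
  "apply_lipb f \<in> borel_measurable borel"
  by (intro borel_measurable_continuous_onI lipschitz_on_continuous_on[OF lipschitz_norm_lipb])

lemma lipb_power2_le: "(apply_lipb f y)\<^sup>2 \<le> (norm f)\<^sup>2"
  by (metis abs_le_norm_lipb power2_abs power_mono abs_ge_zero)

lemma integrable_apply_lipb:
  assumes "prob_space M" "sets M = sets borel"
  shows "integrable M (apply_lipb f)" "integrable M (\<lambda>y. (apply_lipb f y)\<^sup>2)"
proof -
  interpret prob_space M by fact
  have [measurable]: "apply_lipb f \<in> borel_measurable M"
    using apply_lipb_measurable[of f] assms(2) by (simp cong: measurable_cong_sets)
  show "integrable M (apply_lipb f)"
    by (rule integrable_const_bound[of _ "norm f"]) (auto simp: abs_le_norm_lipb)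
  show "integrable M (\<lambda>y. (apply_lipb f y)\<^sup>2)"
    by (intro integrable_const_bound[of _ "(norm f)\<^sup>2"]) (auto simp: lipb_power2_le)
qed

lemma abs_integral_lipb_le:
  assumes "prob_space M" "sets M = sets borel"
  shows "\<bar>\<integral>y. apply_lipb f y \<partial>M\<bar> \<le> norm f"
proof -
  interpret prob_space M by fact
  have *: "-norm f \<le> apply_lipb f y \<and> apply_lipb f y \<le> norm f" for y
    using abs_le_norm_lipb[of f y] by linarith
  have "(\<integral>y. apply_lipb f y \<partial>M) \<le> norm f" "-norm f \<le> (\<integral>y. apply_lipb f y \<partial>M)"
    using * integrable_apply_lipb[OF assms, of f]
    by (auto intro!: integral_le_const integral_ge_const)
  then show ?thesis by linarith
qed

lemma markov_kernelD:
  assumes "markov_kernel P"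
  shows "prob_space (P x)" "sets (P x) = sets borel"
  using measurable_space[OF assms[unfolded markov_kernel_def], of x]
  by (auto simp: space_prob_algebra)

lemma integral_bind_kernel:
  assumes P: "markov_kernel P" and \<mu>: "\<mu> \<in> space (prob_algebra borel)"
  shows "(\<integral>y. apply_lipb f y \<partial>(\<mu> \<bind> P)) = (\<integral>x. kernel_op P (apply_lipb f) x \<partial>\<mu>)"
proof -
  have \<mu>': "prob_space \<mu>" "sets \<mu> = sets borel"
    using \<mu> by (auto simp: space_prob_algebra)
  interpret prob_space \<mu> by fact
  have N: "P \<in> \<mu> \<rightarrow>\<^sub>M subprob_algebra borel"
    using measurable_prob_algebraD[OF P[unfolded markov_kernel_def]] \<mu>'(2)
    by (simp cong: measurable_cong_sets)
  show ?thesis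
    unfolding kernel_op_def
    by (rule integral_bind[OF _ _ N, where B = "norm f" and B' = 1])
      (auto simp: abs_le_norm_lipb finite_measure_axioms not_empty
        prob_space.emeasure_space_1[OF markov_kernelD(1)[OF P]] one_ennreal_def[symmetric])
qed

text \<open>
  The right-hand side of the gradient estimate is at most \<open>(\<gamma> + \<delta>)\<close> times the squared norm of \<open>f\<close>,
  since both the slope and the values of \<open>f\<close> are bounded by the norm and \<open>P\<close> has mass one. The
  constant \<open>c\<close> takes the place of \<open>b (Pf)\<^sup>2\<close>.
\<close>

lemma slope_kernel_op_le:
  fixes P :: "'a::metric_space \<Rightarrow> 'a measure"
  assumes P: "markov_kernel P" and par: "a > 0" "\<gamma> \<ge> 0" "\<delta> \<ge> 0"
    and le: "ennreal a * (slope (kernel_op P (apply_lipb f)) x)\<^sup>2 + c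
      \<le> ennreal \<gamma> * (\<integral>\<^sup>+ y. (slope (apply_lipb f) y)\<^sup>2 \<partial>P x)
        + ennreal \<delta> * (\<integral>\<^sup>+ y. ennreal ((apply_lipb f y)\<^sup>2) \<partial>P x)"
  shows "slope (kernel_op P (apply_lipb f)) x \<le> ennreal (sqrt ((\<gamma> + \<delta>) / a) * norm f)"
proof -
  interpret prob_space "P x" by (rule markov_kernelD[OF P])
  let ?S = "slope (kernel_op P (apply_lipb f)) x"
  have "(slope (apply_lipb f) y)\<^sup>2 \<le> ennreal ((norm f)\<^sup>2)" for y
  proof -
    have "(slope (apply_lipb f) y)\<^sup>2 \<le> (ennreal (norm f))\<^sup>2"
      by (intro power_mono slope_le_lipschitz lipschitz_norm_lipb) auto
    then show ?thesis by (simp add: ennreal_power)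
  qed
  then have "(\<integral>\<^sup>+ y. (slope (apply_lipb f) y)\<^sup>2 \<partial>P x) \<le> (\<integral>\<^sup>+ y. ennreal ((norm f)\<^sup>2) \<partial>P x)"
    by (rule nn_integral_mono)
  then have 1: "(\<integral>\<^sup>+ y. (slope (apply_lipb f) y)\<^sup>2 \<partial>P x) \<le> ennreal ((norm f)\<^sup>2)"
    by (simp add: emeasure_space_1)
  have "(\<integral>\<^sup>+ y. ennreal ((apply_lipb f y)\<^sup>2) \<partial>P x) \<le> (\<integral>\<^sup>+ y. ennreal ((norm f)\<^sup>2) \<partial>P x)"
    by (intro nn_integral_mono ennreal_leI lipb_power2_le)
  then have 2: "(\<integral>\<^sup>+ y. ennreal ((apply_lipb f y)\<^sup>2) \<partial>P x) \<le> ennreal ((norm f)\<^sup>2)"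
    by (simp add: emeasure_space_1)
  have "ennreal a * ?S\<^sup>2 \<le> ennreal a * ?S\<^sup>2 + c" by simp
  also have "\<dots> \<le> ennreal \<gamma> * ennreal ((norm f)\<^sup>2) + ennreal \<delta> * ennreal ((norm f)\<^sup>2)"
    by (intro order_trans[OF le] add_mono mult_left_mono 1 2) auto
  also have "\<dots> = ennreal ((\<gamma> + \<delta>) * (norm f)\<^sup>2)"
    using par by (simp add: ennreal_mult[symmetric] ennreal_plus[symmetric] distrib_right del: ennreal_plus)
  finally have main: "ennreal a * ?S\<^sup>2 \<le> ennreal ((\<gamma> + \<delta>) * (norm f)\<^sup>2)" .
  show ?thesis
  proof (cases ?S)
    case (real s)
    with main par have "a * s\<^sup>2 \<le> (\<gamma> + \<delta>) * (norm f)\<^sup>2"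
      by (simp add: ennreal_power ennreal_mult[symmetric])
    then have "s\<^sup>2 \<le> (\<gamma> + \<delta>) / a * (norm f)\<^sup>2"
      using par by (simp add: field_simps)
    then have "s \<le> sqrt ((\<gamma> + \<delta>) / a * (norm f)\<^sup>2)"
      by (rule real_le_rsqrt)
    also have "\<dots> = sqrt ((\<gamma> + \<delta>) / a) * norm f"
      by (simp only: real_sqrt_mult real_sqrt_abs abs_norm_cancel)
    finally show ?thesis
      using real by (simp only: ennreal_leI)
  next
    case top
    with main par show ?thesis
      by (simp add: power2_eq_square ennreal_mult_top ennreal_top_mult ennreal_mult_eq_top_iff top_unique)
  qed
qed

text \<open>
  The value is meaningful only if \<open>Pf\<close> is Lipschitz again. This is why the facts below assume a
  Lipschitz bound for \<open>Pf\<close>; its linearity in the norm of \<open>f\<close> makes the operator bounded.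
\<close>

definition lipb_kernel :: "('a::metric_space \<Rightarrow> 'a measure) \<Rightarrow> 'a lipb \<Rightarrow> 'a lipb" where
  "lipb_kernel P f = Lipb (kernel_op P (apply_lipb f))"

lemma
  fixes P :: "'a::metric_space \<Rightarrow> 'a measure"
  assumes P: "markov_kernel P" and C: "C \<ge> 0"
    and Lip: "\<And>f. (C * norm f)-lipschitz_on UNIV (kernel_op P (apply_lipb f))"
  shows apply_lipb_kernel: "apply_lipb (lipb_kernel P f) = kernel_op P (apply_lipb f)"
    and bounded_linear_lipb_kernel: "bounded_linear (lipb_kernel P)"
proof -
  have bd: "\<bar>kernel_op P (apply_lipb f) x\<bar> \<le> norm f" for f x
    unfolding kernel_op_def by (rule abs_integral_lipb_le[OF markov_kernelD[OF P]])
  then have "bounded (range (kernel_op P (apply_lipb f)))" for f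
    by (auto simp: bounded_iff)
  then show app: "apply_lipb (lipb_kernel P f) = kernel_op P (apply_lipb f)" for f
    unfolding lipb_kernel_def using Lip[of f] by (intro Lipb_inverse) auto
  show "bounded_linear (lipb_kernel P)"
  proof (rule bounded_linear_intro)
    show "lipb_kernel P (f + g) = lipb_kernel P f + lipb_kernel P g" for f g
      using integrable_apply_lipb(1)[OF markov_kernelD[OF P]]
      by (intro lipb_eqI) (simp add: app kernel_op_def)
    show "lipb_kernel P (c *\<^sub>R f) = c *\<^sub>R lipb_kernel P f" for c f
      by (intro lipb_eqI) (simp add: app kernel_op_def)
    show "norm (lipb_kernel P f) \<le> norm f * (1 + C)" for f
      using norm_lipb_leI[of "lipb_kernel P f" "norm f" "C * norm f"] bd Lip
      by (simp add: app algebra_simps)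
  qed
qed

section \<open>The image of a subsolutions\<close>

text \<open>
  Integration of \<open>\<gamma> |\<nabla>f|\<^sup>2 + \<delta> f\<^sup>2 \<le> - h\<close> term by term would use additivity and homogeneity of the
  nonnegative integral, hence measurability of \<open>|\<nabla>f|\<close>. If \<open>\<gamma> > 0\<close>, the inequality is therefore first
  solved for \<open>|\<nabla>f|\<^sup>2\<close>, which bounds it by the continuous function \<open>(- h - \<delta> f\<^sup>2) / \<gamma>\<close>; then only
  monotonicity is used for the slope, and linearity for bounded continuous functions.
\<close>

lemma kernel_integral_HJ_le:
  fixes f h :: "'a::metric_space lipb"
  assumes P: "markov_kernel P" and par: "\<gamma> \<ge> 0" "\<delta> \<ge> 0"
    and HJ: "\<And>y. apply_lipb h y + \<gamma> * (enn2real (slope (apply_lipb f) y))\<^sup>2 + \<delta> * (apply_lipb f y)\<^sup>2 \<le> 0"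
  shows "ennreal \<gamma> * (\<integral>\<^sup>+ y. (slope (apply_lipb f) y)\<^sup>2 \<partial>P x)
      + ennreal \<delta> * (\<integral>\<^sup>+ y. ennreal ((apply_lipb f y)\<^sup>2) \<partial>P x)
    \<le> ennreal (- kernel_op P (apply_lipb h) x)"
proof -
  interpret prob_space "P x" by (rule markov_kernelD[OF P])
  note int = integrable_apply_lipb[OF markov_kernelD[OF P], of x]
  define u where "u y = - apply_lipb h y - \<delta> * (apply_lipb f y)\<^sup>2" for y
  define q where "q = (\<integral>y. (apply_lipb f y)\<^sup>2 \<partial>P x)"
  have q: "q \<ge> 0" "(\<integral>\<^sup>+ y. ennreal ((apply_lipb f y)\<^sup>2) \<partial>P x) = ennreal q"
    unfolding q_def by (auto intro!: nn_integral_eq_integral int)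
  have u_int: "integrable (P x) u"
    unfolding u_def using int by auto
  have u: "\<gamma> * (enn2real (slope (apply_lipb f) y))\<^sup>2 \<le> u y" for y
    using HJ[of y] by (simp add: u_def)
  have u0: "0 \<le> u y" for y
    using u[of y] par by (meson order_trans zero_le_power2 mult_nonneg_nonneg)
  have Pu: "(\<integral>y. u y \<partial>P x) = - kernel_op P (apply_lipb h) x - \<delta> * q"
    unfolding u_def q_def kernel_op_def using int by simp
  have "ennreal \<gamma> * (\<integral>\<^sup>+ y. (slope (apply_lipb f) y)\<^sup>2 \<partial>P x) \<le> ennreal (\<integral>y. u y \<partial>P x)"
  proof (cases "\<gamma> = 0")
    case False
    with par have \<gamma>: "\<gamma> > 0" by simp
    have "(slope (apply_lipb f) y)\<^sup>2 \<le> ennreal (u y / \<gamma>)" for y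
    proof -
      have "slope (apply_lipb f) y = ennreal (enn2real (slope (apply_lipb f) y))"
        using slope_le_lipschitz[OF lipschitz_norm_lipb[of f], of y]
        by (metis ennreal_enn2real_if ennreal_neq_top top_unique)
      then have "(slope (apply_lipb f) y)\<^sup>2 = ennreal ((enn2real (slope (apply_lipb f) y))\<^sup>2)"
        by (metis ennreal_power enn2real_nonneg)
      also have "\<dots> \<le> ennreal (u y / \<gamma>)"
        using u[of y] \<gamma> by (intro ennreal_leI) (simp add: field_simps)
      finally show ?thesis .
    qed
    then have "(\<integral>\<^sup>+ y. (slope (apply_lipb f) y)\<^sup>2 \<partial>P x) \<le> (\<integral>\<^sup>+ y. ennreal (u y / \<gamma>) \<partial>P x)"
      by (rule nn_integral_mono)
    also have "\<dots> = ennreal (\<integral>y. u y / \<gamma> \<partial>P x)"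
      using u_int u0 \<gamma> by (intro nn_integral_eq_integral) auto
    also have "\<dots> = ennreal ((\<integral>y. u y \<partial>P x) / \<gamma>)" by simp
    finally have "ennreal \<gamma> * (\<integral>\<^sup>+ y. (slope (apply_lipb f) y)\<^sup>2 \<partial>P x)
        \<le> ennreal \<gamma> * ennreal ((\<integral>y. u y \<partial>P x) / \<gamma>)"
      by (intro mult_left_mono) auto
    also have "\<dots> = ennreal (\<integral>y. u y \<partial>P x)"
      using \<gamma> u0 by (simp add: ennreal_mult[symmetric] integral_nonneg)
    finally show ?thesis .
  qed simp
  then have "ennreal \<gamma> * (\<integral>\<^sup>+ y. (slope (apply_lipb f) y)\<^sup>2 \<partial>P x)
      + ennreal \<delta> * (\<integral>\<^sup>+ y. ennreal ((apply_lipb f y)\<^sup>2) \<partial>P x)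
      \<le> ennreal (\<integral>y. u y \<partial>P x) + ennreal (\<delta> * q)"
    using q par by (intro add_mono) (auto simp: ennreal_mult)
  also have "\<dots> = ennreal ((\<integral>y. u y \<partial>P x) + \<delta> * q)"
    using q par u0 by (simp add: ennreal_plus integral_nonneg)
  also have "\<dots> = ennreal (- kernel_op P (apply_lipb h) x)"
    by (simp add: Pu)
  finally show ?thesis .
qed

text \<open>
  The sign of \<open>w\<close> matters: for \<open>w > 0\<close> the right-hand side of the assumption is truncated to \<open>0\<close>, and the
  conclusion fails for \<open>S = 0\<close> and \<open>v = 0\<close>. In the application \<open>w\<close> is the time derivative of a
  subsolution.
\<close>

lemma HJ_inequality_real_of_ennreal:
  assumes "ennreal a * S\<^sup>2 + ennreal b * ennreal (v\<^sup>2) \<le> ennreal (- w)"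
    and "S < \<top>" "a > 0" "b \<ge> 0" "w \<le> 0"
  shows "w + a * (enn2real S)\<^sup>2 + b * v\<^sup>2 \<le> 0"
proof -
  obtain s where s: "S = ennreal s" "s \<ge> 0"
    using assms(2) by (cases S) auto
  have "ennreal (a * s\<^sup>2 + b * v\<^sup>2) \<le> ennreal (- w)"
    using assms s by (simp add: ennreal_power ennreal_mult ennreal_plus)
  then have "a * s\<^sup>2 + b * v\<^sup>2 \<le> - w"
    using assms(5) by (subst (asm) ennreal_le_iff) auto
  with s show ?thesis by simp
qed

lemma HJ_time_derivative_nonpos:
  assumes "a \<ge> 0" "b \<ge> 0" "(h::real) + a * (r::real)\<^sup>2 + b * v\<^sup>2 \<le> 0"
  shows "h \<le> 0"
  using assms by (smt (verit) mult_nonneg_nonneg zero_le_power2)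

theorem theorem3p4:
  fixes P :: "'a::polish_space \<Rightarrow> 'a measure" and a b \<gamma> \<delta> :: real
  assumes "proper_space TYPE('a)"
    and "length_space TYPE('a)"
    and "markov_kernel P"
    and "a > 0" and "b \<ge> 0" and "\<gamma> \<ge> 0" and "\<delta> \<ge> 0"
    and "\<And>(f :: 'a lipb) x.
      ennreal a * (slope (kernel_op P (apply_lipb f)) x)\<^sup>2
        + ennreal b * ennreal ((kernel_op P (apply_lipb f) x)\<^sup>2)
      \<le> ennreal \<gamma> * (\<integral>\<^sup>+ y. (slope (apply_lipb f) y)\<^sup>2 \<partial>P x)
        + ennreal \<delta> * (\<integral>\<^sup>+ y. ennreal ((apply_lipb f y)\<^sup>2) \<partial>P x)"
  shows "\<forall>\<mu>0 \<in> space (prob_algebra borel). \<forall>\<mu>1 \<in> space (prob_algebra borel).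
    W_dist \<gamma> \<delta> (\<mu>0 \<bind> P) (\<mu>1 \<bind> P) \<le> W_dist a b \<mu>0 \<mu>1"
proof (intro ballI)
  note P = assms(3) and grad = assms(8)
  fix \<mu>0 \<mu>1 :: "'a measure"
  assume \<mu>: "\<mu>0 \<in> space (prob_algebra borel)" "\<mu>1 \<in> space (prob_algebra borel)"
  define C where "C = sqrt ((\<gamma> + \<delta>) / a)"
  have C: "C \<ge> 0" using assms(4,6,7) by (simp add: C_def)
  have slope: "slope (kernel_op P (apply_lipb f)) x \<le> ennreal (C * norm f)" for f x
    unfolding C_def by (rule slope_kernel_op_le[OF P assms(4,6,7) grad])
  have Lip: "(C * norm f)-lipschitz_on UNIV (kernel_op P (apply_lipb f))" for f
    using C by (intro slope_le_imp_lipschitz[OF assms(2)] slope) auto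
  note app = apply_lipb_kernel[OF P C Lip]
  interpret T: bounded_linear "lipb_kernel P"
    by (rule bounded_linear_lipb_kernel[OF P C Lip])
  show "W_dist \<gamma> \<delta> (\<mu>0 \<bind> P) (\<mu>1 \<bind> P) \<le> W_dist a b \<mu>0 \<mu>1"
    unfolding W_dist_def
  proof (rule SUP_mono)
    fix \<phi> :: "real \<Rightarrow> 'a lipb" assume "\<phi> \<in> HJ_class \<gamma> \<delta>"
    then obtain \<phi>' where cont: "continuous_on {0..1} \<phi>'"
      and deriv: "\<And>s. s \<in> {0..1} \<Longrightarrow> (\<phi> has_vector_derivative \<phi>' s) (at s within {0..1})"
      and HJ: "\<And>s x. s \<in> {0..1} \<Longrightarrow> apply_lipb (\<phi>' s) x
          + \<gamma> * (enn2real (slope (apply_lipb (\<phi> s)) x))\<^sup>2 + \<delta> * (apply_lipb (\<phi> s) x)\<^sup>2 \<le> 0"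
      unfolding HJ_class_def by blast
    have "apply_lipb (lipb_kernel P (\<phi>' s)) x + a * (enn2real (slope (apply_lipb (lipb_kernel P (\<phi> s))) x))\<^sup>2
        + b * (apply_lipb (lipb_kernel P (\<phi> s)) x)\<^sup>2 \<le> 0" if s: "s \<in> {0..1}" for s x
    proof (rule HJ_inequality_real_of_ennreal)
      show "ennreal a * (slope (apply_lipb (lipb_kernel P (\<phi> s))) x)\<^sup>2
          + ennreal b * ennreal ((apply_lipb (lipb_kernel P (\<phi> s)) x)\<^sup>2)
          \<le> ennreal (- apply_lipb (lipb_kernel P (\<phi>' s)) x)"
        unfolding app
        by (rule order_trans[OF grad kernel_integral_HJ_le[OF P assms(6,7) HJ[OF s]]])
      show "slope (apply_lipb (lipb_kernel P (\<phi> s))) x < \<top>"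
        unfolding app using slope[of "\<phi> s" x] by (rule le_less_trans) simp
      have "apply_lipb (\<phi>' s) y \<le> 0" for y
        using HJ_time_derivative_nonpos[OF assms(6,7) HJ[OF s]] .
      then show "apply_lipb (lipb_kernel P (\<phi>' s)) x \<le> 0"
        using Bochner_Integration.integral_nonneg[of "P x" "\<lambda>y. - apply_lipb (\<phi>' s) y"]
        by (simp add: app kernel_op_def)
    qed (use assms(4,5) in auto)
    then have "lipb_kernel P \<circ> \<phi> \<in> HJ_class a b"
      unfolding HJ_class_def
      using T.has_vector_derivative[OF deriv] T.continuous_on[OF cont]
      by (auto intro!: exI[of _ "\<lambda>s. lipb_kernel P (\<phi>' s)"] simp: o_def)
    then show "\<exists>\<psi>\<in>HJ_class a b.
        ereal ((\<integral>x. apply_lipb (\<phi> 1) x \<partial>(\<mu>1 \<bind> P)) - (\<integral>x. apply_lipb (\<phi> 0) x \<partial>(\<mu>0 \<bind> P)))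
        \<le> ereal ((\<integral>x. apply_lipb (\<psi> 1) x \<partial>\<mu>1) - (\<integral>x. apply_lipb (\<psi> 0) x \<partial>\<mu>0))"
      by (intro bexI[of _ "lipb_kernel P \<circ> \<phi>"]) (simp_all add: app integral_bind_kernel[OF P] \<mu>)
  qed
qed

end
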